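(* Let $T\in\mathbb N$, $s^0\in\mathbb N$, $\delta^\star\ge0$ and $\delta^0\ge0$. Assume that we observe the random element $y=\beta^\star\Phi_T(\vartheta^\star)+w_T$ of $L^2(\lambda_T)$ with unknown parameters $s\in\mathbb N$, $\beta^\star\in(\mathbb R^* )^s$ and $\vartheta^\star\in\Theta_T^s(\delta^\star)$. Let $\beta^0\in(\mathbb R^* )^{s^0}$ and $\vartheta^0\in\Theta_T^{s^0}(\delta^0)$. Suppose that the smoothness assumption on the features holds, and that the Noise Assumption holds for a noise level $\overline\sigma>0$ and a decay rate $\Delta_T>0$ (see context for both). Let $\Xi_T=\mathrm{Var}(\|w_T\|^2_{L^2(\lambda_T)})$. Then the minimax separation rate $\rho^\star(\alpha)$ for the test problem $H_0$ against $H_1(\rho)$ defined in the context satisfies, for any $\alpha\in(0,1)$, $$\rho^\star(\alpha)\le\rho^{(1)}(\alpha)\quad\text{with}\quad\rho^{(1)}(\alpha):=\max\left(\left(\frac{40\,\Xi_T}{\alpha}\right)^{1/4},\ 8\,\overline\sigma\sqrt{2\Delta_T\log\left(\frac2\alpha\right)}\right).$$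
   Context: **Model.** $\mathbb N=\{0,1,\dots\}$, $\mathbb R^*=\mathbb R\setminus\{0\}$. $\Theta$ is either $\mathbb R$ or the torus $\mathbb R/\mathbb Z$, with Lebesgue measure $\mathrm{Leb}$; $|x-y|$ is the Euclidean distance on $\Theta$. $T\in\mathbb N$ is an index, $\lambda_T$ is a measure on the Borel $\sigma$-field of $\Theta$, $\mathfrak S\subset(0,\infty)$ is a set of scale parameters, $\sigma_T\in\mathfrak S$, and $h:\Theta\times\mathfrak S\to\mathbb R$. The features are $\varphi_T(\theta)=h(\theta-\cdot,\sigma_T)\in L^2(\lambda_T)$, normalized as $\phi_T(\theta)=\varphi_T(\theta)/\|\varphi_T(\theta)\|_{L^2(\lambda_T)}$. $\Theta_T$ is a compact interval of $\Theta$ ($\Theta_T=\Theta$ is allowed on the torus). For $\vartheta=(\theta_1,\dots,\theta_s)\in\Theta^s$ and $\beta\in\mathbb R^s$ write $\beta\Phi_T(\vartheta)=\sum_{k=1}^s\beta_k\phi_T(\theta_k)$; for $s=0$, $A^0=\{0\}$ for any set $A$ and $\beta\Phi_T(\vartheta)=0$. For $\delta\ge0$, $A^s(\delta)=\{(\theta_1,\dots,\theta_s)\in A^s:|\theta_\ell-\theta_k|>\delta\text{ for all distinct }k,\ell\}$, $A^0(\delta)=\{0\}$, $A^1(\delta)=A$. The noise $w_T$ is a random element of $L^2(\lambda_T)$. **Noise Assumption** (noise level $\overline\sigma>0$, decay rate $\Delta_T>0$). $w_T$ is a Gaussian process with $\mathbb E[\|w_T\|_{L^2(\lambda_T)}^4]<\infty$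 and, for all $f\in L^2(\lambda_T)$, $\langle f,w_T\rangle_{L^2(\lambda_T)}$ is a centered Gaussian variable with variance at most $\overline\sigma^2\Delta_T\|f\|^2_{L^2(\lambda_T)}$. **Smoothness of the features.** $\theta\mapsto h(\theta,\sigma_T)$ is of class $\mathcal C^3$ on $\Theta$, $\|h(\cdot,\sigma_T)\|_{L^2(\mathrm{Leb})}=1$, and for all $\theta\in\Theta$ and $i\in\{0,\dots,3\}$: $\|h(\theta-\cdot,\sigma_T)\|_{L^2(\lambda_T)}>0$, $\|\partial_\theta^ih(\cdot,\sigma_T)\|_{L^2(\mathrm{Leb})}<\infty$, $\|\partial_\theta^ih(\theta-\cdot,\sigma_T)\|_{L^2(\lambda_T)}<\infty$. **Test problem.** For given $\beta^0,\vartheta^0$ and $\rho\ge0$ (and given $s$, $\delta^\star$): $H_0$: $(\beta^\star,\vartheta^\star)\in(\mathbb R^* )^s\times\Theta_T^s(\delta^\star)$ with $\beta^\star\Phi_T(\vartheta^\star)=\beta^0\Phi_T(\vartheta^0)$; $H_1(\rho)$: $(\beta^\star,\vartheta^\star)\in(\mathbb R^* )^s\times\Theta_T^s(\delta^\star)$ with $\|\beta^\star\Phi_T(\vartheta^\star)-\beta^0\Phi_T(\vartheta^0)\|_{L^2(\lambda_T)}\ge\rho$. A test $\Psi$ is a measurable function of $y$ with values in $\{0,1\}$. Its maximal testing risk is $$R_\rho(\Psi)=\sup_{(\beta^\star,\vartheta^\star)\in H_0}\mathbb E_{(\beta^\star,\vartheta^\star)}[\Psi]+\sup_{(\beta^\star,\vartheta^\star)\in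 H_1(\rho)}\mathbb E_{(\beta^\star,\vartheta^\star)}[1-\Psi],$$ where under $\mathbb E_{(\beta^\star,\vartheta^\star)}$ one has $y=\beta^\star\Phi_T(\vartheta^\star)+w_T$. Under $H_0$ one has $y=\beta^0\Phi_T(\vartheta^0)+w_T$, and the first term (maximal type I error) is written $\mathbb E_{(\beta^0,\vartheta^0)}[\Psi]$. The minimax testing risk is $R^\star_\rho=\inf_\Psi R_\rho(\Psi)$ (infimum over measurable functions from $L^2(\lambda_T)$ to $\{0,1\}$) and the minimax separation rate is $\rho^\star(\alpha)=\inf\{\rho>0:R^\star_\rho\le\alpha\}$. *)

theory Defs
  imports "HOL-Probability.Probability"
begin

section \<open>The parameter space: the real line or the torus\<close>

text \<open>
  \<open>pt\<close> is the canonical homomorphism from the real line. Its kernel is \<open>{0}\<close> or the integers and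
  the metric is the quotient metric, so that, up to isometric isomorphism, the only instances are
  the real line and the torus (the reals modulo the integers); both instances are given below.
\<close>

class line_or_torus = ab_group_add + metric_space +
  fixes pt :: "real \<Rightarrow> 'a"
  assumes pt_add: "pt (x + y) = pt x + pt y"
    and pt_surj: "surj pt"
    and pt_kernel: "{x. pt x = 0} = {0} \<or> {x. pt x = 0} = \<int>"
    and dist_pt: "dist (pt x) (pt y) = Inf {\<bar>x - y + k\<bar> | k. pt k = 0}"

instantiation real :: line_or_torus
begin

definition pt_real_def: "pt (x::real) = x"

instance
  by standard (auto simp: pt_real_def dist_real_def)

end

lemma round_dist_minimum:
  fixes x :: real
  shows "\<bar>x - of_int (round x)\<bar> = Inf {\<bar>x + k\<bar> | k. k \<in> \<int>}"
proof (rule sym, rule cInf_eq_minimum)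
  show "\<bar>x - of_int (round x)\<bar> \<in> {\<bar>x + k\<bar> | k. k \<in> \<int>}"
    by (rule CollectI, rule exI[of _ "- of_int (round x)"]) auto
next
  fix y assume "y \<in> {\<bar>x + k\<bar> | k. k \<in> \<int>}"
  then obtain m :: int where "y = \<bar>x + of_int m\<bar>"
    by (auto elim!: Ints_cases)
  with round_diff_minimal[of x "- m"] show "\<bar>x - of_int (round x)\<bar> \<le> y"
    by simp
qed

lemma round_dist_le: "\<bar>x - of_int (round x)\<bar> \<le> \<bar>x - of_int m\<bar>" for x :: real
  by (rule round_diff_minimal)

lemma round_dist_cong:
  fixes x y :: real
  assumes "x - y \<in> \<int>"
  shows "\<bar>x - of_int (round x)\<bar> = \<bar>y - of_int (round y)\<bar>"
proof -
  obtain m where m: "x = y + of_int m"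
    using assms by (auto elim!: Ints_cases simp: diff_eq_eq add.commute intro: that)
  show ?thesis
    using round_dist_le[of x "round y + m"] round_dist_le[of y "round x - m"]
    by (simp add: m)
qed

quotient_type torus = real / "\<lambda>x y. x - y \<in> \<int>"
proof (rule equivpI)
  show "reflp (\<lambda>x y. x - y \<in> (\<int>::real set))"
    by (simp add: reflp_def)
  show "symp (\<lambda>x y. x - y \<in> (\<int>::real set))"
  proof (rule sympI)
    fix x y :: real
    assume "x - y \<in> \<int>"
    then have "- (x - y) \<in> \<int>" by (rule Ints_minus)
    then show "y - x \<in> \<int>" by simp
  qed
  show "transp (\<lambda>x y. x - y \<in> (\<int>::real set))"
  proof (rule transpI)
    fix x y z :: real
    assume "x - y \<in> \<int>" "y - z \<in> \<int>"
    then have "(x - y) + (y - z) \<in> \<int>" by (rule Ints_add)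
    then show "x - z \<in> \<int>" by simp
  qed
qed

instantiation torus :: ab_group_add
begin

lift_definition zero_torus :: torus is 0 .

lift_definition plus_torus :: "torus \<Rightarrow> torus \<Rightarrow> torus" is "(+)"
proof -
  fix a b c d :: real
  assume "a - b \<in> \<int>" "c - d \<in> \<int>"
  then have "(a - b) + (c - d) \<in> \<int>" by (rule Ints_add)
  then show "(a + c) - (b + d) \<in> \<int>" by (simp add: algebra_simps)
qed

lift_definition uminus_torus :: "torus \<Rightarrow> torus" is uminus
proof -
  fix a b :: real
  assume "a - b \<in> \<int>"
  then have "- (a - b) \<in> \<int>" by (rule Ints_minus)
  then show "- a - - b \<in> \<int>" by (simp add: algebra_simps)
qed

lift_definition minus_torus :: "torus \<Rightarrow> torus \<Rightarrow> torus" is "(-)"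
proof -
  fix a b c d :: real
  assume "a - b \<in> \<int>" "c - d \<in> \<int>"
  then have "(a - b) - (c - d) \<in> \<int>" by (rule Ints_diff)
  then show "(a - c) - (b - d) \<in> \<int>" by (simp add: algebra_simps)
qed

instance
  by standard (transfer, simp add: algebra_simps)+

end

instantiation torus :: metric_space
begin

lift_definition dist_torus :: "torus \<Rightarrow> torus \<Rightarrow> real"
  is "\<lambda>x y. \<bar>(x - y) - of_int (round (x - y))\<bar>"
proof -
  fix a b c d :: real
  assume "a - b \<in> \<int>" "c - d \<in> \<int>"
  then have "(a - b) - (c - d) \<in> \<int>" by (rule Ints_diff)
  then have "(a - c) - (b - d) \<in> \<int>" by (simp add: algebra_simps)
  then show "\<bar>(a - c) - of_int (round (a - c))\<bar> = \<bar>(b - d) - of_int (round (b - d))\<bar>"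
    by (rule round_dist_cong)
qed

definition uniformity_torus :: "(torus \<times> torus) filter"
  where "uniformity_torus = (INF e\<in>{0 <..}. principal {(x, y). dist x y < e})"

definition open_torus :: "torus set \<Rightarrow> bool"
  where "open_torus U = (\<forall>x\<in>U. eventually (\<lambda>(x', y). x' = x \<longrightarrow> y \<in> U) uniformity)"

instance
proof
  fix x y z :: torus
  show "dist x y = 0 \<longleftrightarrow> x = y"
  proof transfer
    fix x y :: real
    have "x - y \<in> \<int>" if "x - y - of_int (round (x - y)) = 0"
    proof -
      have "x - y = of_int (round (x - y))" using that by simp
      then show ?thesis by (metis Ints_of_int)
    qed
    moreover have "x - y - of_int (round (x - y)) = 0" if "x - y \<in> \<int>"
      using that by (auto elim!: Ints_cases)
    ultimately show "(\<bar>x - y - of_int (round (x - y))\<bar> = 0) = (x - y \<in> \<int>)"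
      by auto
  qed
  show "dist x y \<le> dist x z + dist y z"
  proof transfer
    fix x y z :: real
    have "\<bar>x - y - of_int (round (x - y))\<bar>
        \<le> \<bar>x - y - of_int (round (x - z) - round (y - z))\<bar>"
      by (rule round_dist_le)
    also have "\<dots> \<le> \<bar>x - z - of_int (round (x - z))\<bar> + \<bar>y - z - of_int (round (y - z))\<bar>"
      by simp
    finally show "\<bar>x - y - of_int (round (x - y))\<bar>
        \<le> \<bar>x - z - of_int (round (x - z))\<bar> + \<bar>y - z - of_int (round (y - z))\<bar>" .
  qed
qed (rule uniformity_torus_def open_torus_def)+

end

instantiation torus :: line_or_torus
begin

lift_definition pt_torus :: "real \<Rightarrow> torus" is "\<lambda>x. x" .

instance
proof
  fix x y :: real
  show "pt (x + y) = (pt x + pt y :: torus)"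
    by transfer simp
  show "surj (pt :: real \<Rightarrow> torus)"
  unfolding surj_def
  proof (rule allI)
    fix p :: torus
    show "\<exists>x. p = pt x"
    proof transfer
      fix p :: real
      show "\<exists>x. p - x \<in> \<int>" by (rule exI[of _ p]) simp
    qed
  qed
  have ker: "pt k = (0::torus) \<longleftrightarrow> k \<in> \<int>" for k :: real
    by transfer simp
  then show "{x. pt x = (0::torus)} = {0} \<or> {x. pt x = (0::torus)} = \<int>"
    by auto
  have "dist (pt x) (pt y :: torus) = \<bar>x - y - of_int (round (x - y))\<bar>"
    by transfer simp
  then show "dist (pt x) (pt y :: torus) = Inf {\<bar>x - y + k\<bar> | k. pt k = (0::torus)}"
    by (simp add: ker round_dist_minimum)
qed

end

text \<open>Lebesgue measure: \<open>pt 1 = 0\<close> holds exactly on the torus, where it has total mass one.\<close>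

definition Leb :: "'a::line_or_torus measure"
  where "Leb = distr (restrict_space lborel (if pt 1 = (0::'a) then {0..<1} else UNIV)) borel pt"

lemma continuous_on_pt: "continuous_on A (pt :: real \<Rightarrow> 'a::line_or_torus)"
proof -
  have zero: "pt 0 = (0::'a)"
    using pt_add[of 0 0, where 'a = 'a] by simp
  have "dist (pt x :: 'a) (pt y) \<le> \<bar>x - y\<bar>" for x y
  proof -
    have "Inf {\<bar>x - y + k\<bar> | k. pt k = (0::'a)} \<le> \<bar>x - y\<bar>"
      by (rule cInf_lower) (auto intro!: exI[of _ 0] bdd_belowI[of _ 0] simp: zero)
    then show ?thesis by (simp only: dist_pt)
  qed
  then show ?thesis
    unfolding continuous_on_iff dist_real_def by (meson order_le_less_trans)
qed

lemma Leb_real: "(Leb :: real measure) = lborel"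
proof -
  have "restrict_space lborel UNIV = (lborel :: real measure)"
    by (rule measure_eqI) (auto simp: sets_restrict_space emeasure_restrict_space)
  moreover have "pt = (\<lambda>x::real. x)"
    by (auto simp: pt_real_def)
  moreover have "pt 1 \<noteq> (0::real)"
    by (simp add: pt_real_def)
  moreover have "distr lborel borel (\<lambda>x::real. x) = lborel"
    by (rule distr_id2) simp
  ultimately show ?thesis
    by (simp add: Leb_def)
qed

lemma emeasure_Leb_torus: "emeasure Leb (UNIV :: torus set) = 1"
proof -
  have "pt 1 = (0::torus)"
    by transfer simp
  moreover have "(pt :: real \<Rightarrow> torus) \<in> borel_measurable (restrict_space lborel {0..<1})"
    by (intro measurable_restrict_space1)
       (simp add: borel_measurable_continuous_onI continuous_on_pt)
  ultimately show ?thesis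
    by (simp add: Leb_def emeasure_distr space_restrict_space emeasure_restrict_space)
qed

definition compact_interval :: "'a::line_or_torus set \<Rightarrow> bool"
  where "compact_interval A \<longleftrightarrow> (\<exists>a b. a \<le> b \<and> A = pt ` {a..b})"

text \<open>Derivatives of functions on the parameter space, along the local coordinate
  \<open>t \<mapsto> \<theta> + pt t\<close>. \<open>deriv_on_pt i f\<close> is the derivative of order \<open>i\<close>.\<close>

primrec deriv_on_pt :: "nat \<Rightarrow> ('a::line_or_torus \<Rightarrow> real) \<Rightarrow> 'a \<Rightarrow> real"
  where
    "deriv_on_pt 0 f = f"
  | "deriv_on_pt (Suc i) f = (\<lambda>\<theta>. deriv (\<lambda>t. deriv_on_pt i f (\<theta> + pt t)) 0)"

definition class_C :: "nat \<Rightarrow> ('a::line_or_torus \<Rightarrow> real) \<Rightarrow> bool"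
  where "class_C n f \<longleftrightarrow>
    (\<forall>i<n. \<forall>\<theta>. (\<lambda>t. deriv_on_pt i f (\<theta> + pt t)) differentiable (at 0)) \<and>
    continuous_on UNIV (deriv_on_pt n f)"


section \<open>The space of square-integrable functions\<close>

text \<open>
  Elements of \<open>L\<^sup>2(\<nu>)\<close> are represented by functions, and equality in \<open>L\<^sup>2(\<nu>)\<close> is equality almost
  everywhere. The Borel sets are generated by the sets that are open for the
  seminorm; they are saturated for equality almost everywhere, so that the measurable functions
  on \<open>L2_borel \<nu>\<close> are exactly the Borel functions on the quotient.
\<close>

definition L2_space :: "'a measure \<Rightarrow> ('a \<Rightarrow> real) set"
  where "L2_space \<nu> = {f. f \<in> borel_measurable \<nu> \<and> integrable \<nu> (\<lambda>x. (f x)\<^sup>2)}"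

definition L2_inner :: "'a measure \<Rightarrow> ('a \<Rightarrow> real) \<Rightarrow> ('a \<Rightarrow> real) \<Rightarrow> real"
  where "L2_inner \<nu> f g = (\<integral>x. f x * g x \<partial>\<nu>)"

definition L2_norm :: "'a measure \<Rightarrow> ('a \<Rightarrow> real) \<Rightarrow> real"
  where "L2_norm \<nu> f = sqrt (\<integral>x. (f x)\<^sup>2 \<partial>\<nu>)"

definition L2_open :: "'a measure \<Rightarrow> ('a \<Rightarrow> real) set \<Rightarrow> bool"
  where "L2_open \<nu> U \<longleftrightarrow> U \<subseteq> L2_space \<nu> \<and>
    (\<forall>f\<in>U. \<exists>e>0. \<forall>g\<in>L2_space \<nu>. L2_norm \<nu> (\<lambda>x. g x - f x) < e \<longrightarrow> g \<in> U)"

definition L2_borel :: "'a measure \<Rightarrow> ('a \<Rightarrow> real) measure"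
  where "L2_borel \<nu> = sigma (L2_space \<nu>) {U. L2_open \<nu> U}"


section \<open>Features and their mixtures\<close>

definition feature :: "('a::line_or_torus \<Rightarrow> real \<Rightarrow> real) \<Rightarrow> real \<Rightarrow> 'a \<Rightarrow> 'a \<Rightarrow> real"
  where "feature h \<sigma> \<theta> = (\<lambda>x. h (\<theta> - x) \<sigma>)"

definition normalized_feature ::
    "'a::line_or_torus measure \<Rightarrow> ('a \<Rightarrow> real \<Rightarrow> real) \<Rightarrow> real \<Rightarrow> 'a \<Rightarrow> 'a \<Rightarrow> real"
  where "normalized_feature \<nu> h \<sigma> \<theta> = (\<lambda>x. feature h \<sigma> \<theta> x / L2_norm \<nu> (feature h \<sigma> \<theta>))"

definition smooth_features ::
    "'a::line_or_torus measure \<Rightarrow> ('a \<Rightarrow> real \<Rightarrow> real) \<Rightarrow> real \<Rightarrow> bool"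
  where "smooth_features \<nu> h \<sigma> \<longleftrightarrow>
    class_C 3 (\<lambda>\<theta>. h \<theta> \<sigma>) \<and>
    L2_norm Leb (\<lambda>\<theta>. h \<theta> \<sigma>) = 1 \<and>
    (\<forall>\<theta>. L2_norm \<nu> (feature h \<sigma> \<theta>) > 0) \<and>
    (\<forall>i\<le>3. deriv_on_pt i (\<lambda>u. h u \<sigma>) \<in> L2_space Leb) \<and>
    (\<forall>i\<le>3. \<forall>\<theta>. (\<lambda>x. deriv_on_pt i (\<lambda>u. h u \<sigma>) (\<theta> - x)) \<in> L2_space \<nu>)"

text \<open>Tuples are lists; the empty list is the only tuple of length 0.\<close>

definition nonzero_tuples :: "nat \<Rightarrow> real list set"
  where "nonzero_tuples s = {\<beta>. length \<beta> = s \<and> (\<forall>k<s. \<beta> ! k \<noteq> 0)}"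

definition separated_tuples :: "'a::metric_space set \<Rightarrow> nat \<Rightarrow> real \<Rightarrow> 'a list set"
  where "separated_tuples A s \<delta> = {\<theta>s. length \<theta>s = s \<and> set \<theta>s \<subseteq> A \<and>
    (\<forall>k<s. \<forall>l<s. k \<noteq> l \<longrightarrow> dist (\<theta>s ! l) (\<theta>s ! k) > \<delta>)}"

definition mixture :: "('a \<Rightarrow> 'a \<Rightarrow> real) \<Rightarrow> real list \<Rightarrow> 'a list \<Rightarrow> 'a \<Rightarrow> real"
  where "mixture \<phi> \<beta> \<theta>s = (\<lambda>x. \<Sum>k<length \<theta>s. \<beta> ! k * \<phi> (\<theta>s ! k) x)"


section \<open>The noise\<close>

text \<open>Gaussian random variables may be degenerate (variance 0).\<close>

definition gaussian_rv :: "'w measure \<Rightarrow> ('w \<Rightarrow> real) \<Rightarrow> real \<Rightarrow> real \<Rightarrow> bool"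
  where "gaussian_rv M X \<mu> v \<longleftrightarrow> X \<in> borel_measurable M \<and> v \<ge> 0 \<and>
    (if v = 0 then AE \<omega> in M. X \<omega> = \<mu>
     else distributed M lborel X (normal_density \<mu> (sqrt v)))"

text \<open>A random element of \<open>L\<^sup>2(\<nu>)\<close> is a Gaussian process if its scalar products with elements of
  \<open>L\<^sup>2(\<nu>)\<close> are jointly Gaussian.\<close>

definition gaussian_process :: "'w measure \<Rightarrow> 'a measure \<Rightarrow> ('w \<Rightarrow> 'a \<Rightarrow> real) \<Rightarrow> bool"
  where "gaussian_process M \<nu> w \<longleftrightarrow>
    (\<forall>n (c :: nat \<Rightarrow> real) f. (\<forall>i<n. f i \<in> L2_space \<nu>) \<longrightarrow>
      (\<exists>\<mu> v. gaussian_rv M (\<lambda>\<omega>. \<Sum>i<n. c i * L2_inner \<nu> (f i) (w \<omega>)) \<mu> v))"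

definition noise_assumption ::
    "'w measure \<Rightarrow> 'a measure \<Rightarrow> ('w \<Rightarrow> 'a \<Rightarrow> real) \<Rightarrow> real \<Rightarrow> real \<Rightarrow> bool"
  where "noise_assumption M \<nu> w \<sigma>bar \<Delta> \<longleftrightarrow>
    gaussian_process M \<nu> w \<and>
    integrable M (\<lambda>\<omega>. L2_norm \<nu> (w \<omega>) ^ 4) \<and>
    (\<forall>f\<in>L2_space \<nu>. \<exists>v \<le> \<sigma>bar\<^sup>2 * \<Delta> * (L2_norm \<nu> f)\<^sup>2.
      gaussian_rv M (\<lambda>\<omega>. L2_inner \<nu> f (w \<omega>)) 0 v)"


section \<open>The test problem\<close>

definition null_hypothesis ::
    "'a::line_or_torus measure \<Rightarrow> ('a \<Rightarrow> 'a \<Rightarrow> real) \<Rightarrow> 'a set \<Rightarrow> nat \<Rightarrow> real \<Rightarrow>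
     real list \<Rightarrow> 'a list \<Rightarrow> (real list \<times> 'a list) set"
  where "null_hypothesis \<nu> \<phi> A s \<delta> \<beta>0 \<theta>s0 =
    {(\<beta>, \<theta>s) \<in> nonzero_tuples s \<times> separated_tuples A s \<delta>.
      AE x in \<nu>. mixture \<phi> \<beta> \<theta>s x = mixture \<phi> \<beta>0 \<theta>s0 x}"

definition alternative ::
    "'a::line_or_torus measure \<Rightarrow> ('a \<Rightarrow> 'a \<Rightarrow> real) \<Rightarrow> 'a set \<Rightarrow> nat \<Rightarrow> real \<Rightarrow>
     real list \<Rightarrow> 'a list \<Rightarrow> real \<Rightarrow> (real list \<times> 'a list) set"
  where "alternative \<nu> \<phi> A s \<delta> \<beta>0 \<theta>s0 \<rho> =
    {(\<beta>, \<theta>s) \<in> nonzero_tuples s \<times> separated_tuples A s \<delta>.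
      L2_norm \<nu> (\<lambda>x. mixture \<phi> \<beta> \<theta>s x - mixture \<phi> \<beta>0 \<theta>s0 x) \<ge> \<rho>}"

definition tests :: "'a measure \<Rightarrow> (('a \<Rightarrow> real) \<Rightarrow> real) set"
  where "tests \<nu> = {\<Psi> \<in> borel_measurable (L2_borel \<nu>). \<forall>y\<in>L2_space \<nu>. \<Psi> y \<in> {0, 1}}"

text \<open>Expectation of a nonnegative statistic of the observation \<open>y = f + w\<close>. Risks and separation
  rates are extended nonnegative reals, so that a supremum over an empty set of parameters is 0
  and an infimum over an empty set is infinite.\<close>

definition expect_obs ::
    "'w measure \<Rightarrow> ('w \<Rightarrow> 'a \<Rightarrow> real) \<Rightarrow> ('a \<Rightarrow> real) \<Rightarrow> (('a \<Rightarrow> real) \<Rightarrow> real) \<Rightarrow> ennreal"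
  where "expect_obs M w f g = (\<integral>\<^sup>+\<omega>. ennreal (g (\<lambda>x. f x + w \<omega> x)) \<partial>M)"

definition max_risk ::
    "'w measure \<Rightarrow> ('w \<Rightarrow> 'a \<Rightarrow> real) \<Rightarrow> 'a::line_or_torus measure \<Rightarrow> ('a \<Rightarrow> 'a \<Rightarrow> real) \<Rightarrow>
     'a set \<Rightarrow> nat \<Rightarrow> real \<Rightarrow> real list \<Rightarrow> 'a list \<Rightarrow> real \<Rightarrow> (('a \<Rightarrow> real) \<Rightarrow> real) \<Rightarrow> ennreal"
  where "max_risk M w \<nu> \<phi> A s \<delta> \<beta>0 \<theta>s0 \<rho> \<Psi> =
    (SUP (\<beta>, \<theta>s) \<in> null_hypothesis \<nu> \<phi> A s \<delta> \<beta>0 \<theta>s0.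
       expect_obs M w (mixture \<phi> \<beta> \<theta>s) \<Psi>) +
    (SUP (\<beta>, \<theta>s) \<in> alternative \<nu> \<phi> A s \<delta> \<beta>0 \<theta>s0 \<rho>.
       expect_obs M w (mixture \<phi> \<beta> \<theta>s) (\<lambda>y. 1 - \<Psi> y))"

definition minimax_risk ::
    "'w measure \<Rightarrow> ('w \<Rightarrow> 'a \<Rightarrow> real) \<Rightarrow> 'a::line_or_torus measure \<Rightarrow> ('a \<Rightarrow> 'a \<Rightarrow> real) \<Rightarrow>
     'a set \<Rightarrow> nat \<Rightarrow> real \<Rightarrow> real list \<Rightarrow> 'a list \<Rightarrow> real \<Rightarrow> ennreal"
  where "minimax_risk M w \<nu> \<phi> A s \<delta> \<beta>0 \<theta>s0 \<rho> =
    (INF \<Psi> \<in> tests \<nu>. max_risk M w \<nu> \<phi> A s \<delta> \<beta>0 \<theta>s0 \<rho> \<Psi>)"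

definition separation_rate ::
    "'w measure \<Rightarrow> ('w \<Rightarrow> 'a \<Rightarrow> real) \<Rightarrow> 'a::line_or_torus measure \<Rightarrow> ('a \<Rightarrow> 'a \<Rightarrow> real) \<Rightarrow>
     'a set \<Rightarrow> nat \<Rightarrow> real \<Rightarrow> real list \<Rightarrow> 'a list \<Rightarrow> real \<Rightarrow> ennreal"
  where "separation_rate M w \<nu> \<phi> A s \<delta> \<beta>0 \<theta>s0 \<alpha> =
    Inf {ennreal \<rho> | \<rho>. \<rho> > 0 \<and> minimax_risk M w \<nu> \<phi> A s \<delta> \<beta>0 \<theta>s0 \<rho> \<le> ennreal \<alpha>}"

end

theory Submission
  imports Defs
begin

text \<open>
  The null hypothesis fixes the mean \<open>f\<^sub>0\<close> of the observation, so the goodness of fit can be tested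
  with the energy \<open>\<parallel>y - f\<^sub>0\<parallel>\<^sup>2\<close> alone: at the radius \<open>\<rho>\<close> given by the bound, the test rejects when
  this energy exceeds \<open>E \<parallel>w\<parallel>\<^sup>2 + \<rho>\<^sup>2/4\<close>.

  Under the null hypothesis the energy is \<open>\<parallel>w\<parallel>\<^sup>2\<close>, and by Chebyshev's inequality it exceeds its
  expectation by \<open>\<rho>\<^sup>2/4\<close> with probability at most \<open>16 \<Xi> / \<rho>\<^sup>4 \<le> 2 \<alpha> / 5\<close>. Under the alternative,
  with \<open>y - f\<^sub>0 = g + w\<close> and \<open>r = \<parallel>g\<parallel> \<ge> \<rho>\<close>, the energy is \<open>r\<^sup>2 + 2 \<langle>g, w\<rangle> + \<parallel>w\<parallel>\<^sup>2\<close>. If it stays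
  below the threshold, then either \<open>\<parallel>w\<parallel>\<^sup>2\<close> falls short of its expectation by \<open>\<rho>\<^sup>2/4\<close>, which again
  has probability at most \<open>2 \<alpha> / 5\<close>, or \<open>\<langle>g, w\<rangle> \<le> - r\<^sup>2/4\<close>. This scalar product is centered Gaussian
  with variance at most \<open>\<sigma>\<^sup>2 \<Delta> r\<^sup>2\<close>, so the last event has probability at most
  \<open>exp (- r\<^sup>2 / (32 \<sigma>\<^sup>2 \<Delta>)) \<le> (\<alpha>/2)\<^sup>4 \<le> \<alpha> / 16\<close>. The sum of the three bounds is below \<open>\<alpha>\<close>. The first
  term of the maximum defining \<open>\<rho>\<close> controls the Chebyshev bounds and the second one the Gaussian
  tail. The features enter through the square integrability of the mixtures.

  The test is measurable because its rejection region is the complement of a closed ball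
  (\<open>L2_open_complement_cball\<close>), which rests on the triangle inequality for the seminorm. The
  probabilistic core is \<open>type_I_error_le\<close> and \<open>type_II_error_le\<close>.
\<close>

section \<open>The seminorm of square-integrable functions\<close>

lemma L2_space_borel_measurable: "f \<in> L2_space \<nu> \<Longrightarrow> f \<in> borel_measurable \<nu>"
  and L2_space_integrable_square: "f \<in> L2_space \<nu> \<Longrightarrow> integrable \<nu> (\<lambda>x. (f x)\<^sup>2)"
  by (auto simp: L2_space_def)

lemma integrable_mult_L2_space:
  assumes "f \<in> L2_space \<nu>" "g \<in> L2_space \<nu>"
  shows "integrable \<nu> (\<lambda>x. f x * g x)"
proof (rule Bochner_Integration.integrable_bound)
  show "integrable \<nu> (\<lambda>x. (f x)\<^sup>2 + (g x)\<^sup>2)"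
    using assms by (simp add: L2_space_integrable_square)
  show "(\<lambda>x. f x * g x) \<in> borel_measurable \<nu>"
    using assms by (intro borel_measurable_times L2_space_borel_measurable)
  have "\<bar>a * b\<bar> \<le> a\<^sup>2 + b\<^sup>2" for a b :: real
  proof -
    have "2 * (\<bar>a\<bar> * \<bar>b\<bar>) \<le> a\<^sup>2 + b\<^sup>2"
      using sum_squares_bound[of "\<bar>a\<bar>" "\<bar>b\<bar>"] by (simp add: mult.assoc)
    moreover have "0 \<le> \<bar>a\<bar> * \<bar>b\<bar>" by simp
    ultimately show ?thesis unfolding abs_mult by linarith
  qed
  then show "AE x in \<nu>. norm (f x * g x) \<le> norm ((f x)\<^sup>2 + (g x)\<^sup>2)"
    by simp
qed

lemma L2_space_add:
  assumes "f \<in> L2_space \<nu>" "g \<in> L2_space \<nu>"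
  shows "(\<lambda>x. f x + g x) \<in> L2_space \<nu>"
proof -
  have "integrable \<nu> (\<lambda>x. (f x)\<^sup>2 + (g x)\<^sup>2 + 2 * (f x * g x))"
    using assms by (simp add: L2_space_integrable_square integrable_mult_L2_space)
  then show ?thesis
    using assms by (auto simp: L2_space_def power2_sum mult.assoc intro!: borel_measurable_add)
qed

lemma L2_space_scale: "f \<in> L2_space \<nu> \<Longrightarrow> (\<lambda>x. c * f x) \<in> L2_space \<nu>"
  by (auto simp: L2_space_def power_mult_distrib intro!: borel_measurable_times)

lemma L2_space_diff:
  assumes "f \<in> L2_space \<nu>" "g \<in> L2_space \<nu>"
  shows "(\<lambda>x. f x - g x) \<in> L2_space \<nu>"
  using L2_space_add[OF assms(1) L2_space_scale[OF assms(2), of "- 1"]] by simp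

lemma L2_space_sum:
  assumes "\<And>k. k \<in> A \<Longrightarrow> f k \<in> L2_space \<nu>"
  shows "(\<lambda>x. \<Sum>k\<in>A. f k x) \<in> L2_space \<nu>"
  using assms
proof (induction A rule: infinite_finite_induct)
  case (insert k A)
  then show ?case by (simp add: L2_space_add)
qed (auto simp: L2_space_def)

lemma L2_norm_nonneg: "0 \<le> L2_norm \<nu> f"
  by (simp add: L2_norm_def)

lemma L2_norm_square: "(L2_norm \<nu> f)\<^sup>2 = (\<integral>x. (f x)\<^sup>2 \<partial>\<nu>)"
  by (simp add: L2_norm_def)

lemma L2_norm_minus_commute: "L2_norm \<nu> (\<lambda>x. f x - g x) = L2_norm \<nu> (\<lambda>x. g x - f x)"
  by (simp add: L2_norm_def power2_commute)

lemma L2_norm_square_add: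
  assumes "f \<in> L2_space \<nu>" "g \<in> L2_space \<nu>"
  shows "(L2_norm \<nu> (\<lambda>x. f x + g x))\<^sup>2
    = (L2_norm \<nu> f)\<^sup>2 + 2 * L2_inner \<nu> f g + (L2_norm \<nu> g)\<^sup>2"
proof -
  have "(\<integral>x. (f x + g x)\<^sup>2 \<partial>\<nu>) = (\<integral>x. (f x)\<^sup>2 + 2 * (f x * g x) + (g x)\<^sup>2 \<partial>\<nu>)"
    by (simp add: power2_sum algebra_simps)
  also have "\<dots> = (\<integral>x. (f x)\<^sup>2 \<partial>\<nu>) + 2 * (\<integral>x. f x * g x \<partial>\<nu>) + (\<integral>x. (g x)\<^sup>2 \<partial>\<nu>)"
    using assms by (simp add: L2_space_integrable_square integrable_mult_L2_space)
  finally show ?thesis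
    by (simp add: L2_norm_square L2_inner_def)
qed

text \<open>Expanding \<open>\<parallel>b f - a g\<parallel>\<^sup>2 \<ge> 0\<close> with \<open>a = \<parallel>f\<parallel>\<close> and \<open>b = \<parallel>g\<parallel>\<close> gives the inequality multiplied
  by \<open>2 a b\<close>. When \<open>a b = 0\<close>, one of the functions vanishes almost everywhere.\<close>

lemma L2_inner_le_norm_mult:
  assumes f: "f \<in> L2_space \<nu>" and g: "g \<in> L2_space \<nu>"
  shows "L2_inner \<nu> f g \<le> L2_norm \<nu> f * L2_norm \<nu> g"
proof -
  define a b where "a = L2_norm \<nu> f" and "b = L2_norm \<nu> g"
  note ab = L2_norm_nonneg[of \<nu> f, folded a_def] L2_norm_nonneg[of \<nu> g, folded b_def]
  show ?thesis
  proof (cases "a = 0 \<or> b = 0")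
    case True
    have zero: "AE x in \<nu>. u x = 0" if "u \<in> L2_space \<nu>" "L2_norm \<nu> u = 0" for u
    proof -
      have "(\<integral>x. (u x)\<^sup>2 \<partial>\<nu>) = 0"
        using that(2) by (simp add: L2_norm_def)
      then have "AE x in \<nu>. (u x)\<^sup>2 = 0"
        using integral_nonneg_eq_0_iff_AE[of \<nu> "\<lambda>x. (u x)\<^sup>2"] that(1)
        by (simp add: L2_space_integrable_square)
      then show ?thesis by simp
    qed
    have "AE x in \<nu>. f x * g x = 0"
      using True zero[OF f] zero[OF g] unfolding a_def b_def by auto
    then have "L2_inner \<nu> f g = 0"
      unfolding L2_inner_def by (rule integral_eq_zero_AE)
    then show ?thesis
      using ab by (simp add: a_def b_def)
  next
    case False
    then have pos: "a > 0" "b > 0" using ab by auto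
    have "0 \<le> (\<integral>x. (b * f x + - a * g x)\<^sup>2 \<partial>\<nu>)" by simp
    also have "\<dots> = (L2_norm \<nu> (\<lambda>x. b * f x))\<^sup>2
        + 2 * L2_inner \<nu> (\<lambda>x. b * f x) (\<lambda>x. - a * g x) + (L2_norm \<nu> (\<lambda>x. - a * g x))\<^sup>2"
      using L2_norm_square_add[OF L2_space_scale[OF f, of b] L2_space_scale[OF g, of "- a"]]
      by (simp add: L2_norm_square)
    also have "(L2_norm \<nu> (\<lambda>x. b * f x))\<^sup>2 = b\<^sup>2 * a\<^sup>2"
      by (simp add: L2_norm_square power_mult_distrib a_def)
    also have "(L2_norm \<nu> (\<lambda>x. - a * g x))\<^sup>2 = a\<^sup>2 * b\<^sup>2"
      by (simp add: L2_norm_square power_mult_distrib b_def)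
    also have "L2_inner \<nu> (\<lambda>x. b * f x) (\<lambda>x. - a * g x) = - (a * b * L2_inner \<nu> f g)"
    proof -
      have "(\<lambda>x. b * f x * (- a * g x)) = (\<lambda>x. (- (a * b)) * (f x * g x))"
        by (auto simp: algebra_simps)
      then show ?thesis by (simp add: L2_inner_def)
    qed
    finally have "(a * b) * L2_inner \<nu> f g \<le> (a * b) * (a * b)"
      by (simp add: power2_eq_square algebra_simps)
    then show ?thesis
      using pos unfolding a_def[symmetric] b_def[symmetric]
      by (simp add: mult_le_cancel_left)
  qed
qed

lemma L2_norm_triangle:
  assumes f: "f \<in> L2_space \<nu>" and g: "g \<in> L2_space \<nu>"
  shows "L2_norm \<nu> (\<lambda>x. f x + g x) \<le> L2_norm \<nu> f + L2_norm \<nu> g"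
proof (rule power2_le_imp_le)
  show "(L2_norm \<nu> (\<lambda>x. f x + g x))\<^sup>2 \<le> (L2_norm \<nu> f + L2_norm \<nu> g)\<^sup>2"
    using L2_norm_square_add[OF f g] L2_inner_le_norm_mult[OF f g] by (simp add: power2_sum)
qed (simp add: L2_norm_nonneg)

lemma L2_open_complement_cball:
  assumes f: "f \<in> L2_space \<nu>"
  shows "L2_open \<nu> {y \<in> L2_space \<nu>. c < L2_norm \<nu> (\<lambda>x. y x - f x)}"
  unfolding L2_open_def
proof (intro conjI ballI)
  fix y assume "y \<in> {y \<in> L2_space \<nu>. c < L2_norm \<nu> (\<lambda>x. y x - f x)}"
  then have y: "y \<in> L2_space \<nu>" and c: "c < L2_norm \<nu> (\<lambda>x. y x - f x)" by auto
  show "\<exists>e>0. \<forall>g\<in>L2_space \<nu>. L2_norm \<nu> (\<lambda>x. g x - y x) < e \<longrightarrow>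
      g \<in> {y \<in> L2_space \<nu>. c < L2_norm \<nu> (\<lambda>x. y x - f x)}"
  proof (intro exI[of _ "L2_norm \<nu> (\<lambda>x. y x - f x) - c"] conjI ballI impI)
    fix g assume g: "g \<in> L2_space \<nu>"
      and near: "L2_norm \<nu> (\<lambda>x. g x - y x) < L2_norm \<nu> (\<lambda>x. y x - f x) - c"
    have "L2_norm \<nu> (\<lambda>x. y x - f x) \<le> L2_norm \<nu> (\<lambda>x. y x - g x) + L2_norm \<nu> (\<lambda>x. g x - f x)"
      using L2_norm_triangle[OF L2_space_diff[OF y g] L2_space_diff[OF g f]] by simp
    with near have "c < L2_norm \<nu> (\<lambda>x. g x - f x)"
      by (simp add: L2_norm_minus_commute[of _ y g])
    with g show "g \<in> {y \<in> L2_space \<nu>. c < L2_norm \<nu> (\<lambda>x. y x - f x)}" by simp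
  qed (use c in simp)
qed auto

lemma space_L2_borel: "space (L2_borel \<nu>) = L2_space \<nu>"
  and sets_L2_borel_open: "L2_open \<nu> U \<Longrightarrow> U \<in> sets (L2_borel \<nu>)"
proof -
  have sub: "{U. L2_open \<nu> U} \<subseteq> Pow (L2_space \<nu>)" by (auto simp: L2_open_def)
  show "space (L2_borel \<nu>) = L2_space \<nu>"
    unfolding L2_borel_def by (rule space_measure_of[OF sub])
  show "U \<in> sets (L2_borel \<nu>)" if "L2_open \<nu> U"
    unfolding L2_borel_def sets_measure_of[OF sub] using that by (simp add: sigma_sets.Basic)
qed

lemma borel_measurable_L2_norm: "L2_norm \<nu> \<in> borel_measurable (L2_borel \<nu>)"
  unfolding borel_measurable_iff_greater space_L2_borel
proof
  fix c
  have "(\<lambda>x. 0) \<in> L2_space \<nu>" by (simp add: L2_space_def)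
  from sets_L2_borel_open[OF L2_open_complement_cball[OF this, of c]]
  show "{y \<in> L2_space \<nu>. c < L2_norm \<nu> y} \<in> sets (L2_borel \<nu>)" by simp
qed

lemma mixture_normalized_feature_in_L2_space:
  assumes "smooth_features \<nu> h \<sigma>"
  shows "mixture (normalized_feature \<nu> h \<sigma>) \<beta> \<theta>s \<in> L2_space \<nu>"
proof -
  have "feature h \<sigma> \<theta> \<in> L2_space \<nu>" for \<theta>
  proof -
    have "(\<lambda>x. deriv_on_pt 0 (\<lambda>u. h u \<sigma>) (\<theta> - x)) \<in> L2_space \<nu>"
      using assms unfolding smooth_features_def by blast
    then show ?thesis by (simp add: feature_def)
  qed
  then have "(\<lambda>x. c * normalized_feature \<nu> h \<sigma> \<theta> x) \<in> L2_space \<nu>" for c \<theta>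
    using L2_space_scale[of "feature h \<sigma> \<theta>" \<nu> "c / L2_norm \<nu> (feature h \<sigma> \<theta>)"]
    by (simp add: normalized_feature_def)
  then show ?thesis
    unfolding mixture_def by (intro L2_space_sum)
qed


section \<open>The lower tail of a centered Gaussian variable\<close>

text \<open>On the half-line \<open>x \<le> - a\<close> the centered density is at most \<open>exp (- a\<^sup>2 / (2 v))\<close> times the density
  with the same variance centered at \<open>- a\<close>, because the quotient of the two is
  \<open>exp (a (x + a) / v)\<close> times this constant.\<close>

lemma (in prob_space) gaussian_rv_lower_tail:
  assumes X: "gaussian_rv M X 0 v" and v: "v \<le> V" and V: "0 < V" and a: "0 < a"
  shows "prob {\<omega> \<in> space M. X \<omega> \<le> - a} \<le> exp (- (a\<^sup>2 / (2 * V)))"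
proof (cases "v = 0")
  case True
  then have "AE \<omega> in M. X \<omega> = 0" and "X \<in> borel_measurable M"
    using X by (auto simp: gaussian_rv_def)
  then have "prob {\<omega> \<in> space M. X \<omega> \<le> - a} = 0"
    using a by (subst prob_eq_0) (auto elim!: eventually_mono)
  then show ?thesis by simp
next
  case False
  then have v0: "0 < v" and D: "distributed M lborel X (normal_density 0 (sqrt v))"
    using X by (auto simp: gaussian_rv_def)
  have density_le: "normal_density 0 (sqrt v) x
      \<le> exp (- (a\<^sup>2 / (2 * v))) * normal_density (- a) (sqrt v) x" if "x \<le> - a" for x
  proof -
    have "a * (x + a) \<le> 0"
      using a that by (simp add: mult_le_0_iff)
    then have "(x + a)\<^sup>2 + a\<^sup>2 \<le> x\<^sup>2"
      by (simp add: power2_eq_square algebra_simps)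
    then have "- x\<^sup>2 / (2 * v) \<le> - (a\<^sup>2 / (2 * v)) + - (x + a)\<^sup>2 / (2 * v)"
      using v0 by (simp add: divide_simps)
    then have "exp (- x\<^sup>2 / (2 * v)) \<le> exp (- (a\<^sup>2 / (2 * v))) * exp (- (x + a)\<^sup>2 / (2 * v))"
      by (simp add: exp_add[symmetric])
    then show ?thesis
      using v0 by (simp add: normal_density_def divide_right_mono)
  qed
  have "emeasure M {\<omega> \<in> space M. X \<omega> \<le> - a} = emeasure M (X -` {..- a} \<inter> space M)"
    by (rule arg_cong[where f = "emeasure M"]) auto
  also have "\<dots> = (\<integral>\<^sup>+x. ennreal (normal_density 0 (sqrt v) x) * indicator {..- a} x \<partial>lborel)"
    by (rule distributed_emeasure[OF D]) simp
  also have "\<dots> \<le> (\<integral>\<^sup>+x. ennreal (exp (- (a\<^sup>2 / (2 * v))) * normal_density (- a) (sqrt v) x) \<partial>lborel)"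
    by (rule nn_integral_mono) (auto split: split_indicator intro!: ennreal_leI density_le)
  also have "\<dots> = ennreal (exp (- (a\<^sup>2 / (2 * v))))"
    using v0 by (subst nn_integral_eq_integral) (auto simp: integral_normal_density)
  finally have "prob {\<omega> \<in> space M. X \<omega> \<le> - a} \<le> exp (- (a\<^sup>2 / (2 * v)))"
    by (simp add: emeasure_eq_measure)
  also have "\<dots> \<le> exp (- (a\<^sup>2 / (2 * V)))"
    using v v0 a by (simp add: frac_le)
  finally show ?thesis .
qed


section \<open>The energy test\<close>

definition energy_test :: "'a measure \<Rightarrow> ('a \<Rightarrow> real) \<Rightarrow> real \<Rightarrow> ('a \<Rightarrow> real) \<Rightarrow> real"
  where "energy_test \<nu> f c = indicator {y \<in> L2_space \<nu>. c < (L2_norm \<nu> (\<lambda>x. y x - f x))\<^sup>2}"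

lemma energy_test_in_tests:
  assumes f: "f \<in> L2_space \<nu>" and c: "0 \<le> c"
  shows "energy_test \<nu> f c \<in> tests \<nu>"
proof -
  have "c < (L2_norm \<nu> u)\<^sup>2 \<longleftrightarrow> sqrt c < L2_norm \<nu> u" for u
    using c L2_norm_nonneg[of \<nu> u] real_sqrt_less_iff[of c "(L2_norm \<nu> u)\<^sup>2"] by simp
  then have "{y \<in> L2_space \<nu>. c < (L2_norm \<nu> (\<lambda>x. y x - f x))\<^sup>2} \<in> sets (L2_borel \<nu>)"
    using sets_L2_borel_open[OF L2_open_complement_cball[OF f]] by simp
  then show ?thesis
    unfolding tests_def energy_test_def by (auto split: split_indicator)
qed

lemma (in prob_space) expect_obs_le_prob:
  assumes "A \<in> events" and "\<And>\<omega>. \<omega> \<in> space M \<Longrightarrow> g (\<lambda>x. f x + w \<omega> x) \<le> indicator A \<omega>"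
  shows "expect_obs M w f g \<le> ennreal (prob A)"
proof -
  have "expect_obs M w f g \<le> (\<integral>\<^sup>+\<omega>. indicator A \<omega> \<partial>M)"
    unfolding expect_obs_def
  proof (rule nn_integral_mono)
    fix \<omega> assume "\<omega> \<in> space M"
    from ennreal_leI[OF assms(2)[OF this]]
    show "ennreal (g (\<lambda>x. f x + w \<omega> x)) \<le> indicator A \<omega>"
      by (simp add: ennreal_indicator)
  qed
  also have "\<dots> = ennreal (prob A)"
    using assms(1) by (simp add: emeasure_eq_measure)
  finally show ?thesis .
qed

text \<open>Noise with square-integrable energy, with \<open>K\<close> the variance proxy \<open>\<sigma>\<^sup>2 \<Delta>\<close> of its scalar
  products.\<close>

locale gaussian_noise = prob_space M for M :: "'w measure" +
  fixes \<nu> :: "'a measure" and w :: "'w \<Rightarrow> 'a \<Rightarrow> real" and K :: real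
  assumes noise_measurable: "w \<in> M \<rightarrow>\<^sub>M L2_borel \<nu>"
    and fourth_moment: "integrable M (\<lambda>\<omega>. L2_norm \<nu> (w \<omega>) ^ 4)"
    and gaussian_inner: "f \<in> L2_space \<nu> \<Longrightarrow>
      \<exists>v \<le> K * (L2_norm \<nu> f)\<^sup>2. gaussian_rv M (\<lambda>\<omega>. L2_inner \<nu> f (w \<omega>)) 0 v"
    and K_pos: "0 < K"
begin

abbreviation energy :: "'w \<Rightarrow> real"
  where "energy \<omega> \<equiv> (L2_norm \<nu> (w \<omega>))\<^sup>2"

lemma noise_in_L2_space: "\<omega> \<in> space M \<Longrightarrow> w \<omega> \<in> L2_space \<nu>"
  using measurable_space[OF noise_measurable] by (simp add: space_L2_borel)

lemma energy_measurable[measurable]: "energy \<in> borel_measurable M"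
  using measurable_compose[OF noise_measurable borel_measurable_L2_norm] by measurable

lemma energy_deviation:
  assumes "0 < t"
  shows "prob {\<omega> \<in> space M. t \<le> \<bar>energy \<omega> - expectation energy\<bar>} \<le> variance energy / t\<^sup>2"
  using assms fourth_moment
  by (intro Chebyshev_inequality energy_measurable) (simp_all flip: power_mult)

lemma type_I_error_le:
  assumes f: "f \<in> L2_space \<nu>" and f0: "f0 \<in> L2_space \<nu>"
    and eq: "AE x in \<nu>. f x = f0 x" and t: "0 < t"
  shows "expect_obs M w f (energy_test \<nu> f0 (expectation energy + t))
    \<le> ennreal (variance energy / t\<^sup>2)"
proof -
  define A where "A = {\<omega> \<in> space M. t \<le> \<bar>energy \<omega> - expectation energy\<bar>}"
  have "expect_obs M w f (energy_test \<nu> f0 (expectation energy + t)) \<le> ennreal (prob A)"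
  proof (rule expect_obs_le_prob)
    show "A \<in> events" unfolding A_def by measurable
    fix \<omega> assume \<omega>: "\<omega> \<in> space M"
    have "(\<integral>x. (f x + w \<omega> x - f0 x)\<^sup>2 \<partial>\<nu>) = (\<integral>x. (w \<omega> x)\<^sup>2 \<partial>\<nu>)"
      using eq L2_space_borel_measurable[OF f] L2_space_borel_measurable[OF f0]
        L2_space_borel_measurable[OF noise_in_L2_space[OF \<omega>]]
      by (intro integral_cong_AE) (auto elim!: eventually_mono)
    then have "(L2_norm \<nu> (\<lambda>x. f x + w \<omega> x - f0 x))\<^sup>2 = energy \<omega>"
      by (simp add: L2_norm_square)
    then show "energy_test \<nu> f0 (expectation energy + t) (\<lambda>x. f x + w \<omega> x) \<le> indicator A \<omega>"
      using \<omega> by (auto simp: energy_test_def A_def split: split_indicator)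
  qed
  also have "\<dots> \<le> ennreal (variance energy / t\<^sup>2)"
    unfolding A_def by (intro ennreal_leI energy_deviation t)
  finally show ?thesis .
qed

text \<open>The signal adds \<open>r\<^sup>2 \<ge> 4 t\<close> to the energy, where \<open>t = \<rho>\<^sup>2 / 4\<close>. When the test accepts, a part
  \<open>t\<close> of it is absorbed by the threshold, and unless a second part \<open>t\<close> is absorbed by the
  fluctuation of the noise energy, the remaining \<open>r\<^sup>2 - 2 t \<ge> r\<^sup>2 / 2\<close> has to be compensated by the
  cross term \<open>2 \<langle>g, w\<rangle>\<close>.\<close>

lemma type_II_error_le:
  assumes f: "f \<in> L2_space \<nu>" and f0: "f0 \<in> L2_space \<nu>"
    and far: "\<rho> \<le> L2_norm \<nu> (\<lambda>x. f x - f0 x)" and \<rho>: "0 < \<rho>"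
  shows "expect_obs M w f (\<lambda>y. 1 - energy_test \<nu> f0 (expectation energy + \<rho>\<^sup>2 / 4) y)
    \<le> ennreal (variance energy / (\<rho>\<^sup>2 / 4)\<^sup>2 + exp (- (\<rho>\<^sup>2 / (32 * K))))"
proof -
  define g where "g = (\<lambda>x. f x - f0 x)"
  define r where "r = L2_norm \<nu> g"
  define A where "A = {\<omega> \<in> space M. \<rho>\<^sup>2 / 4 \<le> \<bar>energy \<omega> - expectation energy\<bar>}"
  define B where "B = {\<omega> \<in> space M. L2_inner \<nu> g (w \<omega>) \<le> - (r\<^sup>2 / 4)}"
  have g: "g \<in> L2_space \<nu>"
    unfolding g_def by (rule L2_space_diff[OF f f0])
  have r: "\<rho> \<le> r" "0 < r" "\<rho>\<^sup>2 \<le> r\<^sup>2"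
    using far \<rho> power_mono[of \<rho> r 2] by (auto simp: r_def g_def)
  obtain v where v: "v \<le> K * r\<^sup>2" "gaussian_rv M (\<lambda>\<omega>. L2_inner \<nu> g (w \<omega>)) 0 v"
    using gaussian_inner[OF g] unfolding r_def by blast
  have events: "A \<in> events" "B \<in> events"
  proof -
    show "A \<in> events" unfolding A_def by measurable
    have [measurable]: "(\<lambda>\<omega>. L2_inner \<nu> g (w \<omega>)) \<in> borel_measurable M"
      using v(2) by (simp add: gaussian_rv_def)
    show "B \<in> events" unfolding B_def by measurable
  qed
  have "expect_obs M w f (\<lambda>y. 1 - energy_test \<nu> f0 (expectation energy + \<rho>\<^sup>2 / 4) y)
      \<le> ennreal (prob (A \<union> B))"
  proof (rule expect_obs_le_prob)
    show "A \<union> B \<in> events" using events by auto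
    fix \<omega> assume \<omega>: "\<omega> \<in> space M"
    note w = noise_in_L2_space[OF \<omega>]
    have "(\<lambda>x. f x + w \<omega> x - f0 x) = (\<lambda>x. g x + w \<omega> x)"
      by (auto simp: g_def)
    then have energy: "(L2_norm \<nu> (\<lambda>x. f x + w \<omega> x - f0 x))\<^sup>2
        = r\<^sup>2 + 2 * L2_inner \<nu> g (w \<omega>) + energy \<omega>"
      using L2_norm_square_add[OF g w] by (simp add: r_def)
    have "(\<lambda>x. f x + w \<omega> x) \<in> L2_space \<nu>"
      by (rule L2_space_add[OF f w])
    then have accept: "1 - energy_test \<nu> f0 (expectation energy + \<rho>\<^sup>2 / 4) (\<lambda>x. f x + w \<omega> x)
        = (if r\<^sup>2 + 2 * L2_inner \<nu> g (w \<omega>) + energy \<omega> \<le> expectation energy + \<rho>\<^sup>2 / 4 then 1 else 0)"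
      by (simp add: energy_test_def energy indicator_def)
    have "\<omega> \<in> A \<union> B"
      if "r\<^sup>2 + 2 * L2_inner \<nu> g (w \<omega>) + energy \<omega> \<le> expectation energy + \<rho>\<^sup>2 / 4"
    proof (cases "L2_inner \<nu> g (w \<omega>) \<le> - (r\<^sup>2 / 4)")
      case False
      with that r(3) have "\<rho>\<^sup>2 / 4 \<le> - (energy \<omega> - expectation energy)" by linarith
      also have "\<dots> \<le> \<bar>energy \<omega> - expectation energy\<bar>" by (rule abs_ge_minus_self)
      finally show ?thesis using \<omega> unfolding A_def by blast
    qed (use \<omega> in \<open>simp add: B_def\<close>)
    then show "1 - energy_test \<nu> f0 (expectation energy + \<rho>\<^sup>2 / 4) (\<lambda>x. f x + w \<omega> x)
        \<le> indicator (A \<union> B) \<omega>"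
      unfolding accept by (auto simp only: split: if_split split_indicator)
  qed
  also have "\<dots> \<le> ennreal (variance energy / (\<rho>\<^sup>2 / 4)\<^sup>2 + exp (- (\<rho>\<^sup>2 / (32 * K))))"
  proof (rule ennreal_leI)
    have "prob B \<le> exp (- ((r\<^sup>2 / 4)\<^sup>2 / (2 * (K * r\<^sup>2))))"
      unfolding B_def using r(2) K_pos by (intro gaussian_rv_lower_tail[OF v(2,1)]) auto
    also have "(r\<^sup>2 / 4)\<^sup>2 / (2 * (K * r\<^sup>2)) = r\<^sup>2 / (32 * K)"
      using r(2) K_pos by (simp add: power2_eq_square)
    also have "exp (- (r\<^sup>2 / (32 * K))) \<le> exp (- (\<rho>\<^sup>2 / (32 * K)))"
      using r(3) K_pos by (simp add: divide_right_mono)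
    finally have "prob B \<le> exp (- (\<rho>\<^sup>2 / (32 * K)))" .
    moreover have "prob A \<le> variance energy / (\<rho>\<^sup>2 / 4)\<^sup>2"
      unfolding A_def using \<rho> by (intro energy_deviation) simp
    moreover have "prob (A \<union> B) \<le> prob A + prob B"
      using events by (intro measure_Un_le)
    ultimately show "prob (A \<union> B) \<le> variance energy / (\<rho>\<^sup>2 / 4)\<^sup>2 + exp (- (\<rho>\<^sup>2 / (32 * K)))"
      by linarith
  qed
  finally show ?thesis .
qed

end


section \<open>The separation rate\<close>

text \<open>The last two hypotheses are what the two terms of the rate provide: \<open>40\<close> leaves \<open>2 \<alpha> / 5\<close> for each
  of the two Chebyshev bounds, and \<open>128 = 4 \<cdot> 32\<close> turns the Gaussian tail into \<open>(\<alpha>/2)\<^sup>4 \<le> \<alpha>/16\<close>.\<close>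

lemma energy_test_risk_budget:
  fixes \<alpha> \<rho> \<Xi> K :: real
  assumes \<alpha>: "0 < \<alpha>" "\<alpha> < 1" and K: "0 < K" and \<rho>: "0 < \<rho>"
    and fourth: "40 * \<Xi> / \<alpha> \<le> \<rho> ^ 4" and square: "128 * K * ln (2 / \<alpha>) \<le> \<rho>\<^sup>2"
  shows "\<Xi> / (\<rho>\<^sup>2 / 4)\<^sup>2 + (\<Xi> / (\<rho>\<^sup>2 / 4)\<^sup>2 + exp (- (\<rho>\<^sup>2 / (32 * K)))) \<le> \<alpha>"
proof -
  have "\<Xi> \<le> (\<alpha> / 40) * \<rho> ^ 4"
    using fourth \<alpha> by (simp add: field_simps)
  then have "\<Xi> / (\<rho>\<^sup>2 / 4)\<^sup>2 \<le> 2 * \<alpha> / 5"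
    using \<rho> by (simp add: power_divide divide_simps flip: power_mult)
  moreover have "exp (- (\<rho>\<^sup>2 / (32 * K))) \<le> \<alpha> / 16"
  proof -
    have "4 * ln (2 / \<alpha>) \<le> \<rho>\<^sup>2 / (32 * K)"
      using square K by (simp add: field_simps)
    then have "exp (- (\<rho>\<^sup>2 / (32 * K))) \<le> exp (4 * - ln (2 / \<alpha>))"
      by simp
    also have "\<dots> = exp (- ln (2 / \<alpha>)) ^ 4"
      using exp_of_nat_mult[of 4 "- ln (2 / \<alpha>)"] by simp
    also have "exp (- ln (2 / \<alpha>)) = \<alpha> / 2"
      using \<alpha> by (simp add: exp_minus)
    also have "(\<alpha> / 2) ^ 4 \<le> \<alpha> / 16"
      using power_decreasing[of 1 4 \<alpha>] \<alpha> by (simp add: power_divide)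
    finally show ?thesis .
  qed
  ultimately show ?thesis using \<alpha> by linarith
qed

theorem corollary4p2:
  fixes M :: "'w measure"
    and T s s0 :: nat
    and lam :: "nat \<Rightarrow> 'a::line_or_torus measure"
    and S :: "real set"
    and sigma :: "nat \<Rightarrow> real"
    and h :: "'a \<Rightarrow> real \<Rightarrow> real"
    and Theta :: "nat \<Rightarrow> 'a set"
    and w :: "nat \<Rightarrow> 'w \<Rightarrow> 'a \<Rightarrow> real"
    and sigmabar :: real
    and Delta :: "nat \<Rightarrow> real"
    and deltastar delta0 :: real
    and beta0 :: "real list"
    and thetas0 :: "'a list"
  assumes "prob_space M"
    and "sets (lam T) = sets borel"
    and "S \<subseteq> {0<..}"
    and "sigma T \<in> S"
    and "compact_interval (Theta T)"
    and "w T \<in> M \<rightarrow>\<^sub>M L2_borel (lam T)"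
    and "deltastar \<ge> 0"
    and "delta0 \<ge> 0"
    and "beta0 \<in> nonzero_tuples s0"
    and "thetas0 \<in> separated_tuples (Theta T) s0 delta0"
    and "smooth_features (lam T) h (sigma T)"
    and "sigmabar > 0"
    and "Delta T > 0"
    and "noise_assumption M (lam T) (w T) sigmabar (Delta T)"
  shows "let Xi = prob_space.variance M (\<lambda>\<omega>. (L2_norm (lam T) (w T \<omega>))\<^sup>2) in
    \<forall>\<alpha>. 0 < \<alpha> \<and> \<alpha> < 1 \<longrightarrow>
      separation_rate M (w T) (lam T) (normalized_feature (lam T) h (sigma T)) (Theta T)
          s deltastar beta0 thetas0 \<alpha>
        \<le> ennreal (max ((40 * Xi / \<alpha>) powr (1 / 4))
                        (8 * sigmabar * sqrt (2 * Delta T * ln (2 / \<alpha>))))"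
proof -
  define \<nu> where "\<nu> = lam T"
  define \<phi> where "\<phi> = normalized_feature \<nu> h (sigma T)"
  define K where "K = sigmabar\<^sup>2 * Delta T"
  define f0 where "f0 = mixture \<phi> beta0 thetas0"
  interpret prob_space M by fact
  interpret gaussian_noise M \<nu> "w T" K
    using assms unfolding noise_assumption_def K_def \<nu>_def by unfold_locales auto
  have mixture: "mixture \<phi> \<beta> \<theta>s \<in> L2_space \<nu>" for \<beta> \<theta>s
    unfolding \<phi>_def \<nu>_def by (rule mixture_normalized_feature_in_L2_space) fact
  have "separation_rate M (w T) \<nu> \<phi> (Theta T) s deltastar beta0 thetas0 \<alpha>
      \<le> ennreal (max ((40 * variance energy / \<alpha>) powr (1 / 4))
                      (8 * sigmabar * sqrt (2 * Delta T * ln (2 / \<alpha>))))"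
    if \<alpha>: "0 < \<alpha>" "\<alpha> < 1" for \<alpha>
  proof -
    define \<rho>1 where "\<rho>1 = (40 * variance energy / \<alpha>) powr (1 / 4)"
    define \<rho>2 where "\<rho>2 = 8 * sigmabar * sqrt (2 * Delta T * ln (2 / \<alpha>))"
    define \<rho> where "\<rho> = max \<rho>1 \<rho>2"
    define \<Psi> where "\<Psi> = energy_test \<nu> f0 (expectation energy + \<rho>\<^sup>2 / 4)"
    have log: "0 < ln (2 / \<alpha>)"
      using \<alpha> by simp
    have \<rho>2: "0 < \<rho>2"
      unfolding \<rho>2_def using assms(12,13) log by simp
    then have \<rho>: "0 < \<rho>"
      by (simp add: \<rho>_def)
    have root: "(x powr (1 / 4)) ^ 4 = x" if "0 \<le> x" for x :: real
      using that by (cases "x = 0") (simp_all add: powr_power)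
    have "0 \<le> 40 * variance energy / \<alpha>"
      using \<alpha> by (intro divide_nonneg_pos mult_nonneg_nonneg variance_positive) auto
    then have "40 * variance energy / \<alpha> = \<rho>1 ^ 4"
      unfolding \<rho>1_def by (rule root[symmetric])
    also have "\<dots> \<le> \<rho> ^ 4"
      by (rule power_mono) (simp_all add: \<rho>_def \<rho>1_def)
    finally have fourth: "40 * variance energy / \<alpha> \<le> \<rho> ^ 4" .
    have "128 * K * ln (2 / \<alpha>) = \<rho>2\<^sup>2"
      unfolding \<rho>2_def K_def using assms(13) log by (simp add: power_mult_distrib)
    also have "\<dots> \<le> \<rho>\<^sup>2"
      using \<rho>2 by (intro power_mono) (simp_all add: \<rho>_def)
    finally have square: "128 * K * ln (2 / \<alpha>) \<le> \<rho>\<^sup>2" .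
    have "\<Psi> \<in> tests \<nu>"
      unfolding \<Psi>_def f0_def by (intro energy_test_in_tests mixture add_nonneg_nonneg) auto
    then have "minimax_risk M (w T) \<nu> \<phi> (Theta T) s deltastar beta0 thetas0 \<rho>
        \<le> max_risk M (w T) \<nu> \<phi> (Theta T) s deltastar beta0 thetas0 \<rho> \<Psi>"
      unfolding minimax_risk_def by (rule INF_lower)
    also have "\<dots> \<le> ennreal (variance energy / (\<rho>\<^sup>2 / 4)\<^sup>2)
        + ennreal (variance energy / (\<rho>\<^sup>2 / 4)\<^sup>2 + exp (- (\<rho>\<^sup>2 / (32 * K))))"
      unfolding max_risk_def
    proof (intro add_mono SUP_least)
      fix p assume "p \<in> null_hypothesis \<nu> \<phi> (Theta T) s deltastar beta0 thetas0"
      then show "(case p of (\<beta>, \<theta>s) \<Rightarrow> expect_obs M (w T) (mixture \<phi> \<beta> \<theta>s) \<Psi>)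
          \<le> ennreal (variance energy / (\<rho>\<^sup>2 / 4)\<^sup>2)"
        using \<rho> unfolding \<Psi>_def null_hypothesis_def f0_def
        by (auto intro!: type_I_error_le mixture)
    next
      fix p assume "p \<in> alternative \<nu> \<phi> (Theta T) s deltastar beta0 thetas0 \<rho>"
      then show "(case p of (\<beta>, \<theta>s) \<Rightarrow> expect_obs M (w T) (mixture \<phi> \<beta> \<theta>s) (\<lambda>y. 1 - \<Psi> y))
          \<le> ennreal (variance energy / (\<rho>\<^sup>2 / 4)\<^sup>2 + exp (- (\<rho>\<^sup>2 / (32 * K))))"
        using \<rho> unfolding \<Psi>_def alternative_def f0_def
        by (auto intro!: type_II_error_le mixture simp del: ennreal_plus)
    qed
    also have "\<dots> = ennreal (variance energy / (\<rho>\<^sup>2 / 4)\<^sup>2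
        + (variance energy / (\<rho>\<^sup>2 / 4)\<^sup>2 + exp (- (\<rho>\<^sup>2 / (32 * K)))))"
      by (rule ennreal_plus[symmetric]) (simp_all add: variance_positive)
    also have "\<dots> \<le> ennreal \<alpha>"
      by (intro ennreal_leI energy_test_risk_budget \<alpha> K_pos \<rho> fourth square)
    finally have "separation_rate M (w T) \<nu> \<phi> (Theta T) s deltastar beta0 thetas0 \<alpha> \<le> ennreal \<rho>"
      unfolding separation_rate_def using \<rho> by (intro Inf_lower) auto
    then show ?thesis
      by (simp only: \<rho>_def \<rho>1_def \<rho>2_def)
  qed
  then show ?thesis
    by (simp only: Let_def \<phi>_def \<nu>_def) blast
qed

end
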